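(* Let $\mathcal{I}\subset\mathbb{N}_0$ be a finite discrete interval with $k_0\in\mathcal{I}$ such that $\operatorname{rank}\varphi(\mathcal{I})$ is maximal, i.e. $\operatorname{rank}\varphi(\hat{\mathcal{I}})=\operatorname{rank}\varphi(\mathcal{I})$ for every finite discrete interval $\hat{\mathcal{I}}$ with $\mathcal{I}\subseteq\hat{\mathcal{I}}\subset\mathbb{N}_0$. Then, for any $\lambda\in\mathbb{C}$, $$d_\lambda=\tilde d_\lambda+2n-\operatorname{rank}\varphi(\mathcal{I}).$$
   Context: Let $n\in\mathbb{N}$, $\mathbb{N}_0=\{0,1,2,\dots\}$ and $\mathcal{J}=\begin{pmatrix}0&I_n\\-I_n&0\end{pmatrix}$. For each $k\in\mathbb{N}_0$ let $S_k,\Psi_k\in\mathbb{C}^{2n\times2n}$ satisfy $S_k^*\mathcal{J}S_k=\mathcal{J}$, $\Psi_k^*=\Psi_k\ge0$ (positive semi-definite) and $\Psi_k\mathcal{J}\Psi_k=0$. Put $V_k=-\mathcal{J}\Psi_kS_k$ and $\mathbb{S}_k(\lambda)=S_k+\lambda V_k$, $\lambda\in\mathbb{C}$; these matrices are invertible. System (S$_\lambda$) is $z_k=\mathbb{S}_k(\lambda)z_{k+1}$, $k\in\mathbb{N}_0$. With $\mathscr{L}(z)_k=\mathcal{J}(z_k-S_kz_{k+1})$, system (S$_\lambda$) is equivalent to $\mathscr{L}(z)_k=\lambda\Psi_kz_k$, $k\in\mathbb{N}_0$. A discrete interval is a nonempty set of the form $I\cap\mathbb{Z}$ with $I$ a real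 interval. Fix $k_0\in\mathbb{N}_0$ and, for each $\lambda\in\mathbb{C}$, let $\Phi(\lambda)$ be the $2n\times2n$ matrix solution of (S$_\lambda$) with $\Phi_{k_0}(\lambda)=I_{2n}$. For a finite discrete interval $\mathcal{I}\subset\mathbb{N}_0$ with $k_0\in\mathcal{I}$ put $\varphi(\lambda,\mathcal{I})=\sum_{k\in\mathcal{I}}\Phi_k^*(\lambda)\Psi_k\Phi_k(\lambda)$. Its rank does not depend on $\lambda$ and is denoted $\operatorname{rank}\varphi(\mathcal{I})$. $\|z\|_\Psi=\big(\sum_{k=0}^\infty z_k^*\Psi_kz_k\big)^{1/2}$, $\ell^2_\Psi(\mathbb{N}_0)$ is the space of sequences in $\mathbb{C}^{2n}$ with $\|z\|_\Psi<\infty$, and $\tilde\ell^2_\Psi(\mathbb{N}_0)$ is the Hilbert space obtained as its quotient by $\{z:\|z\|_\Psi=0\}$; classes are denoted $\tilde z$. The maximal linear relation is $T_{\max}=\{\{\tilde z,\tilde f\}\in\tilde\ell^2_\Psi(\mathbb{N}_0)\times\tilde\ell^2_\Psi(\mathbb{N}_0):\exists\,u\in\tilde z\text{ with }\mathscr{L}(u)=\Psi f\}$, where $\mathscr{L}(u)=\Psi f$ means $\mathscr{L}(u)_k=\Psi_kf_k$ for all $k\in\mathbb{N}_0$. Define $M_\lambda=\{z\in\ell^2_\Psi(\mathbb{N}_0):\mathscr{L}(z)_k=\lambda\Psi_kz_k,\ k\in\mathbb{N}_0\}$, $d_\lambda=\dim M_\lambda$ (the number of linearly independent square summable solutions of (S$_\lambda$)),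 $\widetilde M_\lambda=\{\tilde z\in\tilde\ell^2_\Psi(\mathbb{N}_0):\{\tilde z,\lambda\tilde z\}\in T_{\max}\}$ and $\tilde d_\lambda=\dim\widetilde M_\lambda$ (the deficiency index of the minimal relation). *)

theory Defs
  imports "HOL-Analysis.Analysis" "Jordan_Normal_Form.Missing_VectorSpace"
begin

text \<open>
  Vectors of length \<open>2n\<close> are indexed by \<open>'n + 'n\<close> with \<open>CARD('n) = n\<close>; the summand \<open>Inl\<close> carries
  the first \<open>n\<close> coordinates, \<open>Inr\<close> the last \<open>n\<close>.
\<close>

type_synonym 'n cvec = "complex ^ ('n + 'n)"
type_synonym 'n cmat = "complex ^ ('n + 'n) ^ ('n + 'n)"
type_synonym 'n cseq = "nat \<Rightarrow> 'n cvec"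

definition block_mat ::
  "complex ^ 'n ^ 'n \<Rightarrow> complex ^ 'n ^ 'n \<Rightarrow> complex ^ 'n ^ 'n \<Rightarrow> complex ^ 'n ^ 'n \<Rightarrow> ('n::finite) cmat" where
  "block_mat A B C D = (\<chi> i j.
     (case i of
        Inl a \<Rightarrow> (case j of Inl b \<Rightarrow> A $ a $ b | Inr b \<Rightarrow> B $ a $ b)
      | Inr a \<Rightarrow> (case j of Inl b \<Rightarrow> C $ a $ b | Inr b \<Rightarrow> D $ a $ b)))"

definition symJ :: "('n::finite) cmat" where
  "symJ = block_mat 0 (mat 1) (- mat 1) 0"

definition ctransp :: "complex ^ 'n ^ 'm \<Rightarrow> complex ^ 'm ^ 'n" where
  "ctransp A = (\<chi> i j. cnj (A $ j $ i))"

definition cdot :: "complex ^ 'm \<Rightarrow> complex ^ 'm \<Rightarrow> complex" where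
  "cdot x y = (\<Sum>i\<in>UNIV. cnj (x $ i) * y $ i)"

definition pos_semidef :: "complex ^ 'm ^ 'm \<Rightarrow> bool" where
  "pos_semidef A \<longleftrightarrow> ctransp A = A \<and> (\<forall>x. cdot x (A *v x) \<in> \<real>\<^sub>\<ge>\<^sub>0)"

definition matV :: "(nat \<Rightarrow> 'n cmat) \<Rightarrow> (nat \<Rightarrow> 'n cmat) \<Rightarrow> nat \<Rightarrow> ('n::finite) cmat" where
  "matV S \<Psi> k = - (symJ ** \<Psi> k ** S k)"

text \<open>The coefficient \<open>S\<^sub>k + lam V\<^sub>k\<close>; \<open>mat lam\<close> is the scalar matrix with diagonal \<open>lam\<close>.\<close>

definition matS :: "(nat \<Rightarrow> 'n cmat) \<Rightarrow> (nat \<Rightarrow> 'n cmat) \<Rightarrow> complex \<Rightarrow> nat \<Rightarrow> ('n::finite) cmat" where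
  "matS S \<Psi> lam k = S k + mat lam ** matV S \<Psi> k"

definition opL :: "(nat \<Rightarrow> 'n cmat) \<Rightarrow> 'n cseq \<Rightarrow> ('n::finite) cseq" where
  "opL S z k = symJ *v (z k - S k *v z (Suc k))"

definition fundamental_solution ::
  "(nat \<Rightarrow> 'n cmat) \<Rightarrow> (nat \<Rightarrow> 'n cmat) \<Rightarrow> nat \<Rightarrow> complex \<Rightarrow> (nat \<Rightarrow> ('n::finite) cmat) \<Rightarrow> bool" where
  "fundamental_solution S \<Psi> k\<^sub>0 lam F \<longleftrightarrow>
     (\<forall>k. F k = matS S \<Psi> lam k ** F (Suc k)) \<and> F k\<^sub>0 = mat 1"

definition discrete_interval :: "nat set \<Rightarrow> bool" where
  "discrete_interval I \<longleftrightarrow>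
     I \<noteq> {} \<and> (\<exists>R::real set. is_interval R \<and> real ` I = R \<inter> \<int>)"

definition phi ::
  "(nat \<Rightarrow> 'n cmat) \<Rightarrow> (complex \<Rightarrow> nat \<Rightarrow> 'n cmat) \<Rightarrow> complex \<Rightarrow> nat set \<Rightarrow> ('n::finite) cmat" where
  "phi \<Psi> \<Phi> lam I = (\<Sum>k\<in>I. ctransp (\<Phi> lam k) ** \<Psi> k ** \<Phi> lam k)"

text \<open>
  The common value of the ranks of \<open>phi \<Psi> \<Phi> lam I\<close>, \<open>lam\<close> ranging over all complex numbers. For
  finite discrete intervals \<open>I\<close> containing \<open>k\<^sub>0\<close> and \<open>\<Phi>\<close> normalised at \<open>k\<^sub>0\<close> this value exists:
  \<open>phi \<Psi> \<Phi> lam I *v \<xi> = 0\<close> forces \<open>\<Psi> k *v (\<Phi> lam k *v \<xi>) = 0\<close> on \<open>I\<close>, so that \<open>\<Phi> lam k *v \<xi>\<close> does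
  not depend on \<open>lam\<close> for \<open>k \<in> I\<close>.
\<close>

definition rank_phi ::
  "(nat \<Rightarrow> 'n cmat) \<Rightarrow> (complex \<Rightarrow> nat \<Rightarrow> ('n::finite) cmat) \<Rightarrow> nat set \<Rightarrow> nat" where
  "rank_phi \<Psi> \<Phi> I = (THE r. \<forall>lam. rank (phi \<Psi> \<Phi> lam I) = r)"

text \<open>
  The terms \<open>z\<^sub>k\<^sup>* \<Psi>\<^sub>k z\<^sub>k\<close> are real for positive semidefinite \<open>\<Psi>\<^sub>k\<close>; \<open>Re\<close> only changes the type.
  \<open>psi_norm\<close> is meaningful on \<open>l2_psi\<close> only.
\<close>

definition l2_psi :: "(nat \<Rightarrow> 'n cmat) \<Rightarrow> ('n::finite) cseq set" where
  "l2_psi \<Psi> = {z. summable (\<lambda>k. Re (cdot (z k) (\<Psi> k *v z k)))}"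

definition psi_norm :: "(nat \<Rightarrow> 'n cmat) \<Rightarrow> ('n::finite) cseq \<Rightarrow> real" where
  "psi_norm \<Psi> z = sqrt (\<Sum>k. Re (cdot (z k) (\<Psi> k *v z k)))"

definition psi_class :: "(nat \<Rightarrow> 'n cmat) \<Rightarrow> 'n cseq \<Rightarrow> ('n::finite) cseq set" where
  "psi_class \<Psi> z = {w \<in> l2_psi \<Psi>. psi_norm \<Psi> (\<lambda>k. w k - z k) = 0}"

definition complex_field :: "complex ring" where
  "complex_field = \<lparr>carrier = UNIV, mult = (*), one = 1, zero = 0, add = (+)\<rparr>"

text \<open>
  Complex vector spaces as \<^typ>\<open>('a, 'b) module\<close> records; the fields \<open>mult\<close> and \<open>one\<close> play no role
  there and are set to a dummy value.
\<close>

definition seq_space :: "(complex, ('n::finite) cseq) module" where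
  "seq_space =
     \<lparr>carrier = UNIV, mult = (\<lambda>_ _ _. 0), one = (\<lambda>_. 0), zero = (\<lambda>_. 0),
      add = (\<lambda>z w k. z k + w k), smult = (\<lambda>c z k. c *s z k)\<rparr>"

text \<open>
  The quotient of \<open>l2_psi \<Psi>\<close> by the sequences of norm zero. The operations are the representativewise
  ones: the classes united on the right-hand sides all coincide.
\<close>

definition l2_quot :: "(nat \<Rightarrow> 'n cmat) \<Rightarrow> (complex, ('n::finite) cseq set) module" where
  "l2_quot \<Psi> =
     \<lparr>carrier = psi_class \<Psi> ` l2_psi \<Psi>,
      mult = (\<lambda>_ _. psi_class \<Psi> (\<lambda>_. 0)), one = psi_class \<Psi> (\<lambda>_. 0),
      zero = psi_class \<Psi> (\<lambda>_. 0),
      add = (\<lambda>Z W. \<Union>z\<in>Z. \<Union>w\<in>W. psi_class \<Psi> (\<lambda>k. z k + w k)),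
      smult = (\<lambda>c Z. \<Union>z\<in>Z. psi_class \<Psi> (\<lambda>k. c *s z k))\<rparr>"

definition T_max ::
  "(nat \<Rightarrow> 'n cmat) \<Rightarrow> (nat \<Rightarrow> 'n cmat) \<Rightarrow> (('n::finite) cseq set \<times> 'n cseq set) set" where
  "T_max S \<Psi> =
     {(psi_class \<Psi> z, psi_class \<Psi> f) | z f.
        z \<in> l2_psi \<Psi> \<and> f \<in> l2_psi \<Psi> \<and>
        (\<exists>u \<in> psi_class \<Psi> z. \<forall>k. opL S u k = \<Psi> k *v f k)}"

definition sol_space ::
  "(nat \<Rightarrow> 'n cmat) \<Rightarrow> (nat \<Rightarrow> 'n cmat) \<Rightarrow> complex \<Rightarrow> ('n::finite) cseq set" where
  "sol_space S \<Psi> lam = {z \<in> l2_psi \<Psi>. \<forall>k. opL S z k = lam *s (\<Psi> k *v z k)}"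

definition defect_space ::
  "(nat \<Rightarrow> 'n cmat) \<Rightarrow> (nat \<Rightarrow> 'n cmat) \<Rightarrow> complex \<Rightarrow> ('n::finite) cseq set set" where
  "defect_space S \<Psi> lam =
     {Z \<in> carrier (l2_quot \<Psi>). (Z, lam \<odot>\<^bsub>l2_quot \<Psi>\<^esub> Z) \<in> T_max S \<Psi>}"

definition sol_dim ::
  "(nat \<Rightarrow> 'n cmat) \<Rightarrow> (nat \<Rightarrow> ('n::finite) cmat) \<Rightarrow> complex \<Rightarrow> nat" where
  "sol_dim S \<Psi> lam =
     vectorspace.dim complex_field (seq_space\<lparr>carrier := sol_space S \<Psi> lam\<rparr>)"

definition defect_dim ::
  "(nat \<Rightarrow> 'n cmat) \<Rightarrow> (nat \<Rightarrow> ('n::finite) cmat) \<Rightarrow> complex \<Rightarrow> nat" where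
  "defect_dim S \<Psi> lam =
     vectorspace.dim complex_field ((l2_quot \<Psi>)\<lparr>carrier := defect_space S \<Psi> lam\<rparr>)"

end

theory Submission
  imports Defs
begin

text \<open>
  Evaluation at \<open>k\<^sub>0\<close> identifies the square summable solutions with the space \<open>X\<close> of those initial
  vectors \<open>\<xi>\<close> for which \<open>\<Phi>(lam) \<xi>\<close> is square summable. If \<open>(Z, lam Z)\<close> lies in the maximal relation,
  the representative \<open>u\<close> of \<open>Z\<close> with \<open>L(u) = \<Psi> f\<close> satisfies \<open>\<Psi> f = lam \<Psi> u\<close>, because sequences of norm
  zero are annihilated by every \<open>\<Psi>\<^sub>k\<close>; so \<open>u\<close> is itself a solution and passing to classes maps the solutions
  onto the defect space. The kernel of this map consists of the solutions with \<open>\<Psi>\<^sub>k z\<^sub>k = 0\<close> for all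
  \<open>k\<close>. Restricting the condition to \<open>k \<in> I\<close> gives the null space of \<open>\<phi>(lam, I)\<close>, which can only shrink as
  \<open>I\<close> grows and is therefore stationary once the rank is maximal. Rank-nullity on \<open>X\<close> and for \<open>\<phi>(lam, I)\<close>
  yields the formula.
\<close>

section \<open>Dimensions of abstract complex vector spaces\<close>

text \<open>Links the record-based \<open>vectorspace.dim\<close> to \<open>vec.dim\<close>;
  \<open>mult\<close> and \<open>one\<close> are dummy fields.\<close>

definition vec_module :: "(complex ^ 'm) set \<Rightarrow> (complex, complex ^ 'm) module" where
  "vec_module X = \<lparr>carrier = X, mult = (\<lambda>_ _. 0), one = 0, zero = 0, add = (+), smult = (*s)\<rparr>"

lemma vec_module_simps [simp]:
  "carrier (vec_module X) = X" "\<zero>\<^bsub>vec_module X\<^esub> = 0"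
  "x \<oplus>\<^bsub>vec_module X\<^esub> y = x + y" "c \<odot>\<^bsub>vec_module X\<^esub> x = c *s x"
  by (simp_all add: vec_module_def)

lemma complex_field_simps [simp]:
  "carrier complex_field = UNIV" "\<zero>\<^bsub>complex_field\<^esub> = 0" "\<one>\<^bsub>complex_field\<^esub> = 1"
  "a \<oplus>\<^bsub>complex_field\<^esub> b = a + b" "a \<otimes>\<^bsub>complex_field\<^esub> b = a * b"
  by (simp_all add: complex_field_def)

lemma field_complex_field: "field complex_field"
proof -
  have "\<exists>y. y + x = 0" for x :: complex
    by (rule exI[of _ "- x"]) simp
  then have "cring complex_field"
    by (intro cringI abelian_groupI comm_monoidI) (auto simp: algebra_simps)
  moreover have "\<exists>y. x * y = 1" if "x \<noteq> 0" for x :: complex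
    using that by (intro exI[of _ "inverse x"]) simp
  ultimately show ?thesis
    by (intro cring.cring_fieldI2) auto
qed

text \<open>The axioms hold in \<open>X\<close> and pass through the surjection \<open>T\<close> to
  \<open>W\<close>. Spaces of sequences and of classes obtain their vector space structure this way,
  as images of a space of initial vectors.\<close>

lemma vectorspace_linear_image:
  fixes X :: "(complex ^ 'm) set" and W :: "(complex, 'w, 'b) module_scheme"
  assumes X: "vec.subspace X"
    and T: "T ` X = carrier W" "T 0 = \<zero>\<^bsub>W\<^esub>"
      "\<And>x y. x \<in> X \<Longrightarrow> y \<in> X \<Longrightarrow> T (x + y) = T x \<oplus>\<^bsub>W\<^esub> T y"
      "\<And>c x. x \<in> X \<Longrightarrow> T (c *s x) = c \<odot>\<^bsub>W\<^esub> T x"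
  shows "vectorspace complex_field W"
proof -
  note cl = vec.subspace_0[OF X] vec.subspace_add[OF X] vec.subspace_scale[OF X]
  have im: "\<exists>x\<in>X. w = T x" if "w \<in> carrier W" for w
    using that T(1) by blast
  have TX: "T x \<in> carrier W" if "x \<in> X" for x
    using that T(1) by blast
  have "abelian_group W"
  proof (rule abelian_groupI)
    show "\<zero>\<^bsub>W\<^esub> \<in> carrier W"
      using TX[OF cl(1)] T(2) by simp
  next
    fix u v assume "u \<in> carrier W" "v \<in> carrier W"
    then obtain x y where xy: "x \<in> X" "y \<in> X" "u = T x" "v = T y"
      using im by meson
    show "u \<oplus>\<^bsub>W\<^esub> v \<in> carrier W"
      using xy cl by (simp flip: T(3) add: TX)
    show "u \<oplus>\<^bsub>W\<^esub> v = v \<oplus>\<^bsub>W\<^esub> u"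
      using xy by (simp flip: T(3) add: add.commute)
  next
    fix u v w assume "u \<in> carrier W" "v \<in> carrier W" "w \<in> carrier W"
    then obtain x y z where xyz: "x \<in> X" "y \<in> X" "z \<in> X" "u = T x" "v = T y" "w = T z"
      using im by meson
    show "u \<oplus>\<^bsub>W\<^esub> v \<oplus>\<^bsub>W\<^esub> w = u \<oplus>\<^bsub>W\<^esub> (v \<oplus>\<^bsub>W\<^esub> w)"
      using xyz cl by (simp flip: T(3) add: add.assoc)
  next
    fix u assume "u \<in> carrier W"
    then obtain x where x: "x \<in> X" "u = T x"
      using im by meson
    show "\<zero>\<^bsub>W\<^esub> \<oplus>\<^bsub>W\<^esub> u = u"
      using x cl by (simp flip: T(2,3))
    show "\<exists>y\<in>carrier W. y \<oplus>\<^bsub>W\<^esub> u = \<zero>\<^bsub>W\<^esub>"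
      using x vec.subspace_neg[OF X x(1)] by (intro bexI[of _ "T (- x)"]) (simp_all flip: T(2,3) add: TX)
  qed
  moreover have "cring complex_field"
    using field_complex_field by (simp add: field_def domain_def)
  moreover have "Module.module_axioms complex_field W"
  proof (rule Module.module_axioms.intro, goal_cases)
    case (1 a u)
    then obtain x where x: "x \<in> X" "u = T x"
      using im by meson
    then show ?case
      using cl by (simp flip: T(4) add: TX)
  next
    case (2 a b u)
    then obtain x where x: "x \<in> X" "u = T x"
      using im by meson
    then show ?case
      using cl by (simp flip: T(3,4))
  next
    case (3 a u v)
    then obtain x y where xy: "x \<in> X" "y \<in> X" "u = T x" "v = T y"
      using im by meson
    then show ?case
      using cl by (simp flip: T(3,4))
  next
    case (4 a b u)
    then obtain x where x: "x \<in> X" "u = T x"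
      using im by meson
    then show ?case
      using cl by (simp flip: T(4))
  next
    case (5 u)
    then obtain x where x: "x \<in> X" "u = T x"
      using im by meson
    then show ?case
      using cl by (simp flip: T(4))
  qed
  ultimately show ?thesis
    by (intro vectorspace.intro Module.module.intro field_complex_field)
qed

lemma vectorspace_vec_module:
  "vec.subspace X \<Longrightarrow> vectorspace complex_field (vec_module X)"
  by (rule vectorspace_linear_image[of X "\<lambda>x. x"]) auto

text \<open>Both spans consist of finite linear combinations; induction on the index set identifies
  \<open>V.lincomb\<close> with the ordinary sum.\<close>

lemma vec_module_span:
  assumes X: "vec.subspace X" and B: "B \<subseteq> X"
  shows "LinearCombinations.module.span complex_field (vec_module X) B = vec.span B"
proof -
  interpret V: vectorspace complex_field "vec_module X"
    by (rule vectorspace_vec_module[OF X])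
  have sums: "V.lincomb a A = (\<Sum>v\<in>A. a v *s v)" if "finite A" "A \<subseteq> X" for a A
    using that
  proof (induction rule: finite_induct)
    case empty
    then show ?case
      by (simp add: V.lincomb_def)
  next
    case (insert v A)
    then have "V.lincomb a (insert v A) = a v \<odot>\<^bsub>vec_module X\<^esub> v \<oplus>\<^bsub>vec_module X\<^esub> V.lincomb a A"
      unfolding V.lincomb_def
      by (intro V.finsum_insert) (auto intro!: vec.subspace_scale[OF X])
    with insert show ?case
      by simp
  qed
  have sums: "(u = V.lincomb a A \<and> finite A \<and> A \<subseteq> B)
      \<longleftrightarrow> (u = (\<Sum>v\<in>A. a v *s v) \<and> finite A \<and> A \<subseteq> B)" for a A u
    using sums[of A a] B by auto
  have "V.span B = {V.lincomb a A | a A. finite A \<and> A \<subseteq> B}"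
    by (simp add: V.span_def)
  also have "\<dots> = {\<Sum>v\<in>A. a v *s v | a A. finite A \<and> A \<subseteq> B}"
    by (simp only: sums)
  also have "\<dots> = vec.span B"
    unfolding vec.span_explicit by blast
  finally show ?thesis .
qed

text \<open>\<open>V.dim\<close> is the least size of a finite generating set: a basis attains
  \<open>vec.dim X\<close>, and no set spanning \<open>X\<close> is smaller.\<close>

lemma vec_module_dim:
  assumes X: "vec.subspace X"
  shows "vectorspace.fin_dim complex_field (vec_module X)"
    and "vectorspace.dim complex_field (vec_module X) = vec.dim X"
proof -
  interpret V: vectorspace complex_field "vec_module X"
    by (rule vectorspace_vec_module[OF X])
  obtain B where B: "B \<subseteq> X" "vec.independent B" "X \<subseteq> vec.span B" "card B = vec.dim X"
    using vec.basis_exists by blast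
  have "vec.span B = X"
    using B(3) vec.span_minimal[OF B(1) X] by (rule subset_antisym[rotated])
  then have "V.gen_set B"
    by (simp only: vec_module_span[OF X B(1)] vec_module_simps)
  moreover have "finite B"
    using B(2) vec.finiteI_independent by blast
  moreover have "vec.dim X \<le> card A" if "finite A" "A \<subseteq> X" "V.gen_set A" for A
    using that by (intro vec.dim_le_card) (auto simp: vec_module_span[OF X])
  ultimately show "V.fin_dim" "V.dim = vec.dim X"
    using B unfolding V.fin_dim_def V.dim_def
    by (auto intro!: Least_equality)
qed

text \<open>Rank-nullity with the abstract dimension only on the image side; domain and kernel are
  concrete subspaces. It is applied to matrices, to solutions and to classes of solutions.\<close>

lemma dim_linear_image:
  fixes X :: "(complex ^ 'm) set" and W :: "(complex, 'w, 'b) module_scheme"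
  assumes X: "vec.subspace X"
    and T: "T ` X = carrier W" "T 0 = \<zero>\<^bsub>W\<^esub>"
      "\<And>x y. x \<in> X \<Longrightarrow> y \<in> X \<Longrightarrow> T (x + y) = T x \<oplus>\<^bsub>W\<^esub> T y"
      "\<And>c x. x \<in> X \<Longrightarrow> T (c *s x) = c \<odot>\<^bsub>W\<^esub> T x"
  shows "vectorspace.dim complex_field W + vec.dim {x \<in> X. T x = \<zero>\<^bsub>W\<^esub>} = vec.dim X"
proof -
  interpret V: vectorspace complex_field "vec_module X"
    by (rule vectorspace_vec_module[OF X])
  interpret W: vectorspace complex_field W
    by (rule vectorspace_linear_image[OF X T])
  interpret T: linear_map complex_field "vec_module X" W T
    using T by unfold_locales (auto simp: module_hom_def)
  have ker: "T.kerT = {x \<in> X. T x = \<zero>\<^bsub>W\<^esub>}"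
    by (simp add: T.ker_def)
  have "vec.subspace T.kerT"
    using X T by (auto simp: ker vec.subspace_def)
  then have "vectorspace.dim complex_field (V.vs T.kerT) = vec.dim T.kerT"
    using vec_module_dim(2) by (simp add: vec_module_def)
  moreover have "T.imT = carrier W"
    using T(1) by (simp add: T.im_def)
  ultimately show ?thesis
    using T.rank_nullity[OF vec_module_dim(1)[OF X]] by (simp add: vec_module_dim(2)[OF X] ker)
qed

section \<open>Rank and nullity of a matrix\<close>

text \<open>Expanding the columns in a basis \<open>C\<close> of the column space factors
  \<open>A\<close> through \<open>C\<close>; every row of \<open>A\<close> is then a combination of
  the coefficient vectors indexed by \<open>C\<close>.\<close>

lemma dim_rows_le_dim_columns:
  fixes A :: "'a::field ^ 'n ^ 'm"
  shows "vec.dim (rows A) \<le> vec.dim (columns A)"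
proof -
  obtain C where C: "C \<subseteq> columns A" "vec.independent C" "columns A \<subseteq> vec.span C"
      "card C = vec.dim (columns A)"
    using vec.basis_exists by blast
  have fin: "finite C"
    using C(2) vec.finiteI_independent by blast
  have "\<exists>u. column j A = (\<Sum>c\<in>C. u c *s c)" for j
    using C(3) by (auto simp: vec.span_finite[OF fin] columns_def)
  then obtain u where u: "\<And>j. column j A = (\<Sum>c\<in>C. u j c *s c)"
    by metis
  have "row i A = (\<Sum>c\<in>C. c $ i *s (\<chi> j. u j c))" for i
  proof -
    have "row i A $ j = column j A $ i" for j
      by (simp add: row_def column_def)
    then show ?thesis
      unfolding u by (simp add: vec_eq_iff mult.commute)
  qed
  then have "rows A \<subseteq> vec.span ((\<lambda>c. \<chi> j. u j c) ` C)"
    unfolding rows_def by (force intro: vec.span_sum vec.span_scale vec.span_base)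
  then have "vec.dim (rows A) \<le> card ((\<lambda>c. \<chi> j. u j c) ` C)"
    using fin by (intro vec.dim_le_card) auto
  also have "\<dots> \<le> card C"
    using fin by (rule card_image_le)
  finally show ?thesis
    using C(4) by simp
qed

text \<open>\<open>rank\<close> is the dimension of the row space; the preceding bound for
  \<open>A\<close> and for its transpose gives both inequalities.\<close>

lemma rank_eq_dim_columns:
  fixes A :: "'a::field ^ 'n ^ 'm"
  shows "rank A = vec.dim (columns A)"
  using dim_rows_le_dim_columns[of A] dim_rows_le_dim_columns[of "transpose A"]
  by (simp add: row_rank_def_gen)

lemma subspace_range_matrix:
  fixes A :: "'a::field ^ 'n ^ 'm"
  shows "vec.subspace (range ((*v) A))"
  by (auto simp: vec.subspace_def simp flip: matrix_vector_right_distrib vector_scalar_commute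
      intro!: image_eqI[of 0 _ 0])

lemma rank_eq_dim_range:
  fixes A :: "'a::field ^ 'n ^ 'm"
  shows "rank A = vec.dim (range ((*v) A))"
proof -
  have "range ((*v) A) = vec.span (columns A)"
  proof
    show "range ((*v) A) \<subseteq> vec.span (columns A)"
      unfolding matrix_mult_sum columns_def
      by (force intro: vec.span_sum vec.span_scale vec.span_base)
    note subspace_range_matrix[of A]
    moreover have "column j A = A *v axis j 1" for j
      by (simp add: vec_eq_iff matrix_vector_mult_def column_def axis_def if_distrib cong: if_cong)
    then have "columns A \<subseteq> range ((*v) A)"
      by (auto simp: columns_def)
    ultimately show "vec.span (columns A) \<subseteq> range ((*v) A)"
      by (intro vec.span_minimal)
  qed
  then show ?thesis
    by (simp add: rank_eq_dim_columns)
qed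

lemma rank_plus_nullity:
  fixes A :: "complex ^ 'n ^ 'm"
  shows "rank A + vec.dim {x. A *v x = 0} = CARD('n)"
proof -
  have "vectorspace.dim complex_field (vec_module (range ((*v) A)))
      + vec.dim {x \<in> UNIV. A *v x = \<zero>\<^bsub>vec_module (range ((*v) A))\<^esub>} = vec.dim (UNIV :: (complex ^ 'n) set)"
    by (rule dim_linear_image)
       (auto simp: matrix_vector_right_distrib vector_scalar_commute)
  then show ?thesis
    by (simp add: vec_module_dim(2)[OF subspace_range_matrix] rank_eq_dim_range card_cart_basis vec.dim_UNIV)
qed

section \<open>Positive semidefinite matrices and the symplectic unit\<close>

lemma cdot_simps [simp]:
  "cdot 0 y = 0" "cdot x 0 = 0"
  by (simp_all add: cdot_def)

lemma cdot_add_left: "cdot (x + y) z = cdot x z + cdot y z"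
  and cdot_add_right: "cdot x (y + z) = cdot x y + cdot x z"
  and cdot_diff_left: "cdot (x - y) z = cdot x z - cdot y z"
  and cdot_diff_right: "cdot x (y - z) = cdot x y - cdot x z"
  and cdot_scale_left: "cdot (c *s x) y = cnj c * cdot x y"
  and cdot_scale_right: "cdot x (c *s y) = c * cdot x y"
  and cdot_sum_right: "cdot x (\<Sum>k\<in>A. f k) = (\<Sum>k\<in>A. cdot x (f k))"
  by (simp_all add: cdot_def algebra_simps sum.distrib sum_subtractf sum_distrib_left sum.swap[of _ _ A])

lemma cdot_self: "cdot x x = of_real (\<Sum>i\<in>UNIV. (cmod (x $ i))\<^sup>2)"
  by (simp add: cdot_def complex_norm_square mult.commute del: of_real_power)

lemma cdot_self_eq_0 [simp]: "Re (cdot x x) = 0 \<longleftrightarrow> x = 0"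
  by (simp add: cdot_self sum_nonneg_eq_0_iff vec_eq_iff)

lemma cdot_self_nonneg [simp]: "Re (cdot x x) \<ge> 0"
  by (simp add: cdot_self sum_nonneg)

lemma cdot_adjoint: "cdot (A *v x) y = cdot x (ctransp A *v y)"
  by (simp add: cdot_def ctransp_def matrix_vector_mult_def sum_distrib_left sum_distrib_right
      sum.swap[of _ "UNIV :: 'a set" "UNIV :: 'b set"] mult_ac)

lemma pos_semidef_nonneg: "pos_semidef A \<Longrightarrow> Re (cdot x (A *v x)) \<ge> 0"
  by (simp add: pos_semidef_def complex_nonneg_Reals_iff)

text \<open>At \<open>x - t y\<close> with \<open>y = A *v x\<close> and real \<open>t\<close> the
  form equals \<open>t^2 q - 2 t p\<close>, where \<open>p\<close> is the squared length of
  \<open>y\<close>. Being nonnegative for all \<open>t\<close> forces \<open>p = 0\<close>.\<close>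

lemma pos_semidef_null:
  assumes A: "pos_semidef A" and x: "Re (cdot x (A *v x)) = 0"
  shows "A *v x = 0"
proof -
  define y where "y = A *v x"
  define p where "p = Re (cdot y y)"
  define q where "q = Re (cdot y (A *v y))"
  have sa: "cdot x (A *v y) = cdot y y"
    using A cdot_adjoint[of A x y] by (simp add: y_def pos_semidef_def)
  have *: "2 * t * p \<le> t\<^sup>2 * q" for t :: real
  proof -
    have "Re (cdot (x - of_real t *s y) (A *v (x - of_real t *s y)))
        = Re (cdot x (A *v x)) - 2 * t * p + t\<^sup>2 * q"
      by (simp add: matrix_vector_mult_diff_distrib vector_scalar_commute cdot_diff_left
          cdot_diff_right cdot_scale_left cdot_scale_right sa flip: y_def)
         (simp add: p_def q_def power2_eq_square algebra_simps)
    then show ?thesis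
      using pos_semidef_nonneg[OF A, of "x - of_real t *s y"] x by simp
  qed
  have p0: "p \<ge> 0"
    by (simp add: p_def)
  have "p = 0"
  proof (cases "q = 0")
    case True
    then show ?thesis
      using *[of 1] p0 by simp
  next
    case False
    then have "q > 0"
      using pos_semidef_nonneg[OF A, of y] by (simp add: q_def)
    \<comment> \<open>The value \<open>t = p / q\<close> minimises
      \<open>t^2 q - 2 t p\<close>.\<close>
    then have "2 * (p * p) \<le> p * p"
      using *[of "p / q"] by (simp add: field_simps power2_eq_square)
    then show ?thesis
      using p0 by (auto simp: mult_le_0_iff)
  qed
  then show ?thesis
    by (simp add: p_def flip: y_def)
qed

lemma uminus_matrix_vector_mult: "(- A :: 'a::comm_ring_1 ^ 'n ^ 'm) *v x = - (A *v x)"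
  and matrix_vector_mult_uminus: "(A :: 'a::comm_ring_1 ^ 'n ^ 'm) *v (- x) = - (A *v x)"
  by (simp_all add: vec_eq_iff matrix_vector_mult_def sum_negf)

lemma symJ_nth:
  "symJ $ Inl a $ Inl b = 0" "symJ $ Inl a $ Inr b = (if a = b then 1 else 0)"
  "symJ $ Inr a $ Inl b = (if a = b then - 1 else 0)" "symJ $ Inr a $ Inr b = 0"
  by (simp_all add: symJ_def block_mat_def mat_def)

lemma symJ_symJ: "symJ ** symJ = - mat 1"
proof -
  have sum: "(\<Sum>k\<in>UNIV. f k) = (\<Sum>a\<in>UNIV. f (Inl a)) + (\<Sum>a\<in>UNIV. f (Inr a))"
    for f :: "'a + 'a \<Rightarrow> complex"
    using sum.Plus[of UNIV UNIV f] by (simp add: UNIV_Plus_UNIV)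
  have "(\<Sum>k\<in>UNIV. (symJ :: 'a cmat) $ i $ k * symJ $ k $ j) = - (mat 1 :: 'a cmat) $ i $ j" for i j
    by (cases i; cases j) (simp_all add: sum symJ_nth mult_delta_left mat_def)
  then show ?thesis
    by (simp add: vec_eq_iff matrix_matrix_mult_def)
qed

lemma symJ_mult_symJ_mult: "symJ *v (symJ *v x) = - x"
  by (simp add: matrix_vector_mul_assoc symJ_symJ uminus_matrix_vector_mult)

section \<open>Discrete intervals\<close>

lemma discrete_interval_convex:
  assumes "discrete_interval I" "i \<in> I" "k \<in> I" "i \<le> j" "j \<le> k"
  shows "j \<in> I"
proof -
  obtain R :: "real set" where R: "is_interval R" "real ` I = R \<inter> \<int>"
    using assms(1) by (auto simp: discrete_interval_def)
  have "real i \<in> R" "real k \<in> R"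
    using R(2) assms(2,3) by blast+
  then have "real j \<in> R"
    using R(1) assms(4,5) by (meson is_interval_1 of_nat_mono)
  then have "real j \<in> real ` I"
    by (simp add: R(2))
  then show ?thesis
    by auto
qed

lemma discrete_interval_atLeastAtMost:
  assumes "i \<le> j"
  shows "discrete_interval {i..j}"
  unfolding discrete_interval_def
proof (intro conjI exI)
  show "real ` {i..j} = {real i..real j} \<inter> \<int>"
  proof (intro equalityI subsetI)
    fix x assume "x \<in> {real i..real j} \<inter> \<int>"
    then obtain m :: int where m: "x = of_int m" "real i \<le> of_int m" "of_int m \<le> real j"
      by (auto elim: Ints_cases)
    then have "x = real (nat m)" "nat m \<in> {i..j}"
      by auto
    then show "x \<in> real ` {i..j}"
      by blast
  qed auto
qed (use assms in \<open>auto simp: is_interval_cc\<close>)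

section \<open>Symplectic systems and their solutions\<close>

locale symplectic_system =
  fixes S \<Psi> :: "nat \<Rightarrow> ('n::finite) cmat"
  assumes symplectic: "\<And>k. ctransp (S k) ** symJ ** S k = symJ"
    and psd: "\<And>k. pos_semidef (\<Psi> k)"
    and isotropic: "\<And>k. \<Psi> k ** symJ ** \<Psi> k = 0"
begin

text \<open>Symplecticity recovers \<open>symJ *v z\<close> from \<open>S k *v z\<close>, and
  \<open>symJ\<close> is invertible because its square is \<open>- mat 1\<close>.\<close>

lemma S_cancel:
  assumes "S k *v x = S k *v y"
  shows "x = y"
proof -
  have "symJ *v z = ctransp (S k) *v (symJ *v (S k *v z))" for z
    using symplectic[of k] by (simp add: matrix_vector_mul_assoc matrix_mul_assoc)
  then have "symJ *v (symJ *v x) = symJ *v (symJ *v y)"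
    using assms by metis
  then show ?thesis
    by (simp add: symJ_mult_symJ_mult)
qed

lemma isotropic_vec: "\<Psi> k *v (symJ *v (\<Psi> k *v x)) = 0"
  using isotropic[of k] by (simp add: matrix_vector_mul_assoc matrix_mul_assoc)

text \<open>Square summability is left out, so that every \<open>F k *v \<xi>\<close> with a
  fundamental \<open>F\<close> is covered.\<close>

definition solution :: "complex \<Rightarrow> 'n cseq \<Rightarrow> bool" where
  "solution lam z \<longleftrightarrow> (\<forall>k. opL S z k = lam *s (\<Psi> k *v z k))"

lemma solution_step:
  assumes "solution lam z"
  shows "S k *v z (Suc k) = z k + lam *s (symJ *v (\<Psi> k *v z k))"
proof -
  have "symJ *v (symJ *v (z k - S k *v z (Suc k))) = symJ *v (lam *s (\<Psi> k *v z k))"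
    using assms by (simp add: solution_def opL_def)
  then show ?thesis
    by (simp add: symJ_mult_symJ_mult vector_scalar_commute algebra_simps)
qed

text \<open>The term by which \<open>S k *v z (Suc k)\<close> differs from \<open>z k\<close> lies
  in the range of \<open>symJ ** \<Psi> k\<close>, which \<open>\<Psi> k\<close>
  annihilates.\<close>

lemma solution_Psi:
  assumes "solution lam z"
  shows "\<Psi> k *v (S k *v z (Suc k)) = \<Psi> k *v z k"
  by (simp add: solution_step[OF assms] matrix_vector_right_distrib vector_scalar_commute isotropic_vec)

lemma matS_mult: "matS S \<Psi> lam k *v x = S k *v x - lam *s (symJ *v (\<Psi> k *v (S k *v x)))"
proof -
  have "mat lam *v y = lam *s y" for y :: "'n cvec"
    by (simp add: vec_eq_iff matrix_vector_mult_def mat_def if_distrib if_distribR cong: if_cong)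
  then show ?thesis
    by (simp add: matS_def matV_def matrix_vector_mult_add_rdistrib uminus_matrix_vector_mult
      flip: matrix_vector_mul_assoc)
qed

text \<open>The two forms of the system differ in whether \<open>\<Psi> k\<close> acts on
  \<open>z k\<close> or on \<open>S k *v z (Suc k)\<close>. Isotropy makes both values equal,
  whichever form is assumed.\<close>

lemma solution_iff: "solution lam z \<longleftrightarrow> (\<forall>k. z k = matS S \<Psi> lam k *v z (Suc k))"
proof
  assume *: "solution lam z"
  then show "\<forall>k. z k = matS S \<Psi> lam k *v z (Suc k)"
    by (simp add: matS_mult solution_Psi) (simp add: solution_step)
next
  assume *: "\<forall>k. z k = matS S \<Psi> lam k *v z (Suc k)"
  show "solution lam z"
    unfolding solution_def
  proof
    fix k
    have z: "z k = S k *v z (Suc k) - lam *s (symJ *v (\<Psi> k *v (S k *v z (Suc k))))"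
      using * by (metis matS_mult)
    then have "\<Psi> k *v z k = \<Psi> k *v (S k *v z (Suc k))"
      by (metis diff_zero isotropic_vec matrix_vector_mult_diff_distrib vec.scale_zero_right vector_scalar_commute)
    with z have "z k - S k *v z (Suc k) = - lam *s (symJ *v (\<Psi> k *v z k))"
      by (simp add: algebra_simps)
    then show "opL S z k = lam *s (\<Psi> k *v z k)"
      by (simp add: opL_def vector_scalar_commute symJ_mult_symJ_mult matrix_vector_mult_uminus)
  qed
qed


text \<open>Where \<open>\<Psi> k *v z k = 0\<close> the spectral parameter drops out of the
  equation for \<open>z\<close>. Induction away from \<open>k\<^sub>0\<close> in both directions
  shows that \<open>w\<close> obeys the same parameter-free recursion; convexity of \<open>I\<close>
  keeps the induction inside \<open>I\<close>.\<close>

lemma solution_agree: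
  assumes z: "solution lam z" and w: "solution \<mu> w" and I: "discrete_interval I" "k\<^sub>0 \<in> I"
    and init: "z k\<^sub>0 = w k\<^sub>0" and null: "\<And>k. k \<in> I \<Longrightarrow> \<Psi> k *v z k = 0" and k: "k \<in> I"
  shows "z k = w k"
proof (cases "k\<^sub>0 \<le> k")
  case True
  then show ?thesis
    using k
  proof (induction k rule: dec_induct)
    case (step k)
    have "k \<in> I"
      using discrete_interval_convex[OF I(1,2) step.prems] step.hyps by simp
    then have "z k = w k" "\<Psi> k *v w k = 0"
      using step.IH null[of k] by auto
    then show ?case
      using solution_step[OF z, of k] solution_step[OF w, of k] S_cancel[of k] by simp
  qed (rule init)
next
  case False
  then have "k \<le> k\<^sub>0"
    by simp
  then show ?thesis
    using k
  proof (induction k rule: inc_induct)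
    case (step k)
    have "Suc k \<in> I"
      using discrete_interval_convex[OF I(1) step.prems I(2)] step.hyps by simp
    then have eq: "z (Suc k) = w (Suc k)"
      by (rule step.IH)
    \<comment> \<open>Going down, \<open>w k\<close> is not yet known; its image under
      \<open>\<Psi> k\<close> is determined by \<open>w (Suc k)\<close>, hence equals that of
      \<open>z k\<close>.\<close>
    have "\<Psi> k *v w k = 0"
      using null[OF step.prems] by (simp flip: solution_Psi[OF z] solution_Psi[OF w] eq)
    then show ?case
      using solution_step[OF z, of k] solution_step[OF w, of k] null[OF step.prems] eq by simp
  qed (rule init)
qed

section \<open>The weighted sequence space and its quotient\<close>

definition quad :: "nat \<Rightarrow> 'n cvec \<Rightarrow> real" where
  "quad k x = Re (cdot x (\<Psi> k *v x))"

lemma quad_nonneg: "quad k x \<ge> 0"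
  by (simp add: quad_def pos_semidef_nonneg[OF psd])

lemma quad_eq_0: "quad k x = 0 \<longleftrightarrow> \<Psi> k *v x = 0"
  using pos_semidef_null[OF psd] by (auto simp: quad_def)

lemma quad_scale: "quad k (c *s x) = (cmod c)\<^sup>2 * quad k x"
proof -
  have "cdot (c *s x) (\<Psi> k *v (c *s x)) = of_real ((cmod c)\<^sup>2) * cdot x (\<Psi> k *v x)"
    by (simp add: vector_scalar_commute cdot_scale_left cdot_scale_right complex_norm_square
        mult_ac del: of_real_power)
  then show ?thesis
    by (simp add: quad_def del: of_real_power)
qed

text \<open>The parallelogram identity with the term of \<open>x - y\<close> dropped. It gives
  closure of \<open>l2_psi\<close> under sums by comparison.\<close>

lemma quad_add_le: "quad k (x + y) \<le> 2 * quad k x + 2 * quad k y"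
proof -
  have "quad k (x + y) + quad k (x - y) = 2 * quad k x + 2 * quad k y"
    by (simp add: quad_def matrix_vector_right_distrib matrix_vector_mult_diff_distrib cdot_add_left
        cdot_add_right cdot_diff_left cdot_diff_right)
  then show ?thesis
    using quad_nonneg[of k "x - y"] by linarith
qed

text \<open>Since \<open>\<Psi> k\<close> is self-adjoint, the form depends on a vector only through
  its image under \<open>\<Psi> k\<close>.\<close>

lemma quad_cong:
  assumes "\<Psi> k *v x = \<Psi> k *v y"
  shows "quad k x = quad k y"
proof -
  have "cdot x (\<Psi> k *v y) = cdot (\<Psi> k *v x) y"
    using psd[of k] by (simp add: cdot_adjoint pos_semidef_def)
  also have "\<dots> = cdot y (\<Psi> k *v y)"
    using psd[of k] by (simp add: assms cdot_adjoint pos_semidef_def)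
  finally show ?thesis
    using assms by (simp add: quad_def)
qed

lemma l2_psi_iff: "z \<in> l2_psi \<Psi> \<longleftrightarrow> summable (\<lambda>k. quad k (z k))"
  by (simp add: l2_psi_def quad_def)

lemma l2_psi_zero: "(\<lambda>k. 0) \<in> l2_psi \<Psi>"
  by (simp add: l2_psi_def)

lemma l2_psi_add:
  assumes "z \<in> l2_psi \<Psi>" "w \<in> l2_psi \<Psi>"
  shows "(\<lambda>k. z k + w k) \<in> l2_psi \<Psi>"
  unfolding l2_psi_iff
proof (rule summable_comparison_test')
  show "summable (\<lambda>k. 2 * quad k (z k) + 2 * quad k (w k))"
    using assms unfolding l2_psi_iff by (intro summable_add summable_mult)
  show "norm (quad k (z k + w k)) \<le> 2 * quad k (z k) + 2 * quad k (w k)" for k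
    using quad_add_le[of k "z k" "w k"] by (simp add: quad_nonneg)
qed

lemma l2_psi_scale: "z \<in> l2_psi \<Psi> \<Longrightarrow> (\<lambda>k. c *s z k) \<in> l2_psi \<Psi>"
  by (simp add: l2_psi_iff quad_scale summable_mult)

lemma l2_psi_diff:
  assumes "z \<in> l2_psi \<Psi>" "w \<in> l2_psi \<Psi>"
  shows "(\<lambda>k. z k - w k) \<in> l2_psi \<Psi>"
  using l2_psi_add[OF assms(1) l2_psi_scale[OF assms(2), of "- 1"]] by simp

text \<open>A convergent series of nonnegative terms vanishes only termwise, and a semidefinite form
  vanishes only on the null space of its matrix.\<close>

lemma psi_norm_eq_0:
  assumes "z \<in> l2_psi \<Psi>"
  shows "psi_norm \<Psi> z = 0 \<longleftrightarrow> (\<forall>k. \<Psi> k *v z k = 0)"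
  using assms suminf_eq_zero_iff[of "\<lambda>k. quad k (z k)"]
  by (simp add: psi_norm_def l2_psi_iff quad_nonneg quad_eq_0 flip: quad_def)

text \<open>Reduces equality of classes to pointwise equations. Square summability of
  \<open>w\<close> follows from that of \<open>z\<close>, as \<open>quad_cong\<close> makes their
  terms equal.\<close>

lemma psi_class_eq:
  assumes "z \<in> l2_psi \<Psi>"
  shows "psi_class \<Psi> z = {w. \<forall>k. \<Psi> k *v w k = \<Psi> k *v z k}"
proof -
  have "w \<in> psi_class \<Psi> z \<longleftrightarrow> w \<in> l2_psi \<Psi> \<and> (\<forall>k. \<Psi> k *v w k = \<Psi> k *v z k)" for w
    using assms by (auto simp: psi_class_def psi_norm_eq_0 l2_psi_diff matrix_vector_mult_diff_distrib)
  moreover have "w \<in> l2_psi \<Psi>" if "\<forall>k. \<Psi> k *v w k = \<Psi> k *v z k" for w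
    using that assms quad_cong[of _ "w _" "z _"] by (simp add: l2_psi_iff)
  ultimately show ?thesis
    by blast
qed

lemma psi_class_eq_iff:
  assumes "z \<in> l2_psi \<Psi>" "w \<in> l2_psi \<Psi>"
  shows "psi_class \<Psi> z = psi_class \<Psi> w \<longleftrightarrow> (\<forall>k. \<Psi> k *v z k = \<Psi> k *v w k)"
  unfolding psi_class_eq[OF assms(1)] psi_class_eq[OF assms(2)] by (simp add: set_eq_iff) metis

lemma in_psi_class: "z \<in> l2_psi \<Psi> \<Longrightarrow> z \<in> psi_class \<Psi> z"
  by (simp add: psi_class_eq)

lemma psi_class_subset: "psi_class \<Psi> z \<subseteq> l2_psi \<Psi>"
  by (auto simp: psi_class_def)

text \<open>The union defining the sum runs over a nonempty family of identical classes, so it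
  collapses to any one of them.\<close>

lemma l2_quot_add:
  assumes "z \<in> l2_psi \<Psi>" "w \<in> l2_psi \<Psi>"
  shows "psi_class \<Psi> z \<oplus>\<^bsub>l2_quot \<Psi>\<^esub> psi_class \<Psi> w = psi_class \<Psi> (\<lambda>k. z k + w k)"
proof -
  have "psi_class \<Psi> (\<lambda>k. z' k + w' k) = psi_class \<Psi> (\<lambda>k. z k + w k)"
    if "z' \<in> psi_class \<Psi> z" "w' \<in> psi_class \<Psi> w" for z' w'
  proof -
    have "z' \<in> l2_psi \<Psi>" "w' \<in> l2_psi \<Psi>"
      using that psi_class_subset by auto
    then show ?thesis
      using that assms
      by (subst psi_class_eq_iff) (simp_all add: l2_psi_add psi_class_eq matrix_vector_right_distrib)
  qed
  moreover have "psi_class \<Psi> z \<noteq> {}" "psi_class \<Psi> w \<noteq> {}"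
    using assms in_psi_class by blast+
  ultimately have "(\<Union>z'\<in>psi_class \<Psi> z. \<Union>w'\<in>psi_class \<Psi> w. psi_class \<Psi> (\<lambda>k. z' k + w' k))
      = psi_class \<Psi> (\<lambda>k. z k + w k)"
    by (intro SUP_eq_const)
  then show ?thesis
    by (simp add: l2_quot_def)
qed

lemma l2_quot_smult:
  assumes "z \<in> l2_psi \<Psi>"
  shows "c \<odot>\<^bsub>l2_quot \<Psi>\<^esub> psi_class \<Psi> z = psi_class \<Psi> (\<lambda>k. c *s z k)"
proof -
  have "psi_class \<Psi> (\<lambda>k. c *s z' k) = psi_class \<Psi> (\<lambda>k. c *s z k)"
    if "z' \<in> psi_class \<Psi> z" for z'
  proof -
    have "z' \<in> l2_psi \<Psi>"
      using that psi_class_subset by auto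
    then show ?thesis
      using that assms
      by (subst psi_class_eq_iff) (simp_all add: l2_psi_scale psi_class_eq vector_scalar_commute)
  qed
  moreover have "psi_class \<Psi> z \<noteq> {}"
    using assms in_psi_class by blast
  ultimately have "(\<Union>z'\<in>psi_class \<Psi> z. psi_class \<Psi> (\<lambda>k. c *s z' k)) = psi_class \<Psi> (\<lambda>k. c *s z k)"
    by (intro SUP_eq_const)
  then show ?thesis
    by (simp add: l2_quot_def)
qed

text \<open>Equality of the classes of \<open>f\<close> and \<open>lam u\<close> says that
  \<open>\<Psi> f = lam \<Psi> u\<close> pointwise, which turns the equation for \<open>u\<close>
  into the homogeneous system.\<close>

lemma defect_space_eq: "defect_space S \<Psi> lam = psi_class \<Psi> ` sol_space S \<Psi> lam"
proof
  show "defect_space S \<Psi> lam \<subseteq> psi_class \<Psi> ` sol_space S \<Psi> lam"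
  proof
    fix Z assume "Z \<in> defect_space S \<Psi> lam"
    then obtain z f u where Z: "Z = psi_class \<Psi> z" "lam \<odot>\<^bsub>l2_quot \<Psi>\<^esub> Z = psi_class \<Psi> f"
      and l2: "z \<in> l2_psi \<Psi>" "f \<in> l2_psi \<Psi>"
      and u: "u \<in> psi_class \<Psi> z" "\<And>k. opL S u k = \<Psi> k *v f k"
      by (auto simp: defect_space_def T_max_def)
    have u_l2: "u \<in> l2_psi \<Psi>"
      using u(1) psi_class_subset by auto
    have Zu: "Z = psi_class \<Psi> u"
      using u(1) l2(1) u_l2 by (simp add: Z(1) psi_class_eq)
    then have "psi_class \<Psi> f = psi_class \<Psi> (\<lambda>k. lam *s u k)"
      using Z(2) by (simp add: l2_quot_smult[OF u_l2])
    then have "\<Psi> k *v f k = lam *s (\<Psi> k *v u k)" for k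
      using l2(2) u_l2 by (simp add: psi_class_eq_iff l2_psi_scale vector_scalar_commute)
    then show "Z \<in> psi_class \<Psi> ` sol_space S \<Psi> lam"
      using u(2) u_l2 Zu by (auto simp: sol_space_def)
  qed
  show "psi_class \<Psi> ` sol_space S \<Psi> lam \<subseteq> defect_space S \<Psi> lam"
  proof
    fix Z assume "Z \<in> psi_class \<Psi> ` sol_space S \<Psi> lam"
    then obtain z where Z: "Z = psi_class \<Psi> z" and l2: "z \<in> l2_psi \<Psi>"
      and z: "\<forall>k. opL S z k = \<Psi> k *v (lam *s z k)"
      by (auto simp: sol_space_def vector_scalar_commute)
    \<comment> \<open>The pair is witnessed by \<open>f = lam z\<close> and by \<open>z\<close> as
      its own representative.\<close>
    then have "(Z, psi_class \<Psi> (\<lambda>k. lam *s z k)) \<in> T_max S \<Psi>"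
      unfolding T_max_def
      using l2_psi_scale[OF l2, of lam] in_psi_class[OF l2] by blast
    then show "Z \<in> defect_space S \<Psi> lam"
      using l2 by (simp add: defect_space_def Z l2_quot_smult) (simp add: l2_quot_def)
  qed
qed

section \<open>The fundamental solution\<close>

text \<open>For finite \<open>I\<close> this is the null space of \<open>phi\<close>; for
  \<open>I = UNIV\<close> it is the kernel of the passage from initial vectors to classes.\<close>

definition null_space :: "(nat \<Rightarrow> 'n cmat) \<Rightarrow> nat set \<Rightarrow> 'n cvec set" where
  "null_space F I = {\<xi>. \<forall>k\<in>I. \<Psi> k *v (F k *v \<xi>) = 0}"

lemma phi_null:
  assumes "finite I"
  shows "{\<xi>. phi \<Psi> \<Phi> lam I *v \<xi> = 0} = null_space (\<Phi> lam) I"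
proof -
  have phi: "phi \<Psi> \<Phi> lam I *v \<xi> = (\<Sum>k\<in>I. ctransp (\<Phi> lam k) *v (\<Psi> k *v (\<Phi> lam k *v \<xi>)))" for \<xi>
    using assms unfolding phi_def
    by (induction I rule: finite_induct)
       (simp_all add: matrix_vector_mult_add_rdistrib matrix_vector_mul_assoc matrix_mul_assoc)
  have "\<xi> \<in> null_space (\<Phi> lam) I" if "phi \<Psi> \<Phi> lam I *v \<xi> = 0" for \<xi>
  proof -
    \<comment> \<open>The quadratic form of \<open>phi\<close> at \<open>\<xi>\<close> is a sum of
      nonnegative terms, so all of them vanish with it.\<close>
    have "(\<Sum>k\<in>I. quad k (\<Phi> lam k *v \<xi>)) = Re (cdot \<xi> (phi \<Psi> \<Phi> lam I *v \<xi>))"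
      by (simp add: phi cdot_sum_right quad_def cdot_adjoint)
    then show ?thesis
      using that assms by (simp add: sum_nonneg_eq_0_iff quad_nonneg quad_eq_0 null_space_def)
  qed
  then show ?thesis
    by (auto simp: phi null_space_def)
qed

lemma fundamental_init: "fundamental_solution S \<Psi> k\<^sub>0 lam F \<Longrightarrow> F k\<^sub>0 = mat 1"
  unfolding fundamental_solution_def by blast

lemma solution_fundamental:
  assumes "fundamental_solution S \<Psi> k\<^sub>0 lam F"
  shows "solution lam (\<lambda>k. F k *v \<xi>)"
  unfolding solution_iff
proof
  fix k
  have "F k = matS S \<Psi> lam k ** F (Suc k)"
    using assms unfolding fundamental_solution_def by blast
  then show "F k *v \<xi> = matS S \<Psi> lam k *v (F (Suc k) *v \<xi>)"
    by (simp add: matrix_vector_mul_assoc)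
qed

text \<open>By isotropy \<open>\<Psi> k\<close> takes the same value on
  \<open>matS S \<Psi> lam k *v x\<close> and on \<open>S k *v x\<close>, so the former vector
  determines the latter.\<close>

lemma matS_cancel:
  assumes "matS S \<Psi> lam k *v x = matS S \<Psi> lam k *v y"
  shows "x = y"
proof -
  have "\<Psi> k *v (matS S \<Psi> lam k *v x) = \<Psi> k *v (S k *v x)" for x
    by (simp add: matS_mult matrix_vector_mult_diff_distrib vector_scalar_commute isotropic_vec)
  then have "S k *v x = S k *v y"
    using assms by (metis (no_types) matS_mult diff_add_cancel)
  then show ?thesis
    by (rule S_cancel)
qed

lemma solution_unique:
  assumes "solution lam z" "solution lam w" "z k\<^sub>0 = w k\<^sub>0"
  shows "z = w"
proof
  fix k
  \<comment> \<open>Backward by the recursion itself, forward by injectivity of its coefficient;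
    agreement anywhere thus amounts to agreement at 0.\<close>
  have step: "z k = w k \<longleftrightarrow> z (Suc k) = w (Suc k)" for k
    using assms(1,2) unfolding solution_iff by (metis matS_cancel)
  then have "z k = w k \<longleftrightarrow> z 0 = w 0" for k
    by (induction k) auto
  then show "z k = w k"
    using assms(3) by blast
qed

text \<open>By \<open>solution_agree\<close>, a solution starting in the null space is the same on
  \<open>I\<close> for both parameters. Exchanging the roles of \<open>F\<close> and
  \<open>G\<close> gives equality.\<close>

lemma null_space_const:
  assumes F: "fundamental_solution S \<Psi> k\<^sub>0 lam F" and G: "fundamental_solution S \<Psi> k\<^sub>0 \<mu> G"
    and I: "discrete_interval I" "k\<^sub>0 \<in> I"
  shows "null_space F I \<subseteq> null_space G I"
proof
  fix \<xi> assume \<xi>: "\<xi> \<in> null_space F I"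
  have "F k *v \<xi> = G k *v \<xi>" if "k \<in> I" for k
    using solution_agree[OF solution_fundamental[OF F] solution_fundamental[OF G] I _ _ that]
      \<xi> by (simp add: null_space_def fundamental_init[OF F] fundamental_init[OF G])
  then show "\<xi> \<in> null_space G I"
    using \<xi> by (simp add: null_space_def)
qed

text \<open>The nullity is the same for all parameters, hence so is the rank; this makes the
  description in \<open>rank_phi\<close> denote the common value.\<close>

lemma rank_phi_eq:
  assumes \<Phi>: "\<And>\<mu>. fundamental_solution S \<Psi> k\<^sub>0 \<mu> (\<Phi> \<mu>)"
    and I: "finite I" "discrete_interval I" "k\<^sub>0 \<in> I"
  shows "rank_phi \<Psi> \<Phi> I + vec.dim (null_space (\<Phi> lam) I) = 2 * CARD('n)"
proof -
  have *: "rank (phi \<Psi> \<Phi> \<mu> I) + vec.dim (null_space (\<Phi> \<mu>) I) = 2 * CARD('n)" for \<mu>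
    using rank_plus_nullity[of "phi \<Psi> \<Phi> \<mu> I"] by (simp add: phi_null[OF I(1)])
  have eq: "null_space (\<Phi> \<mu>) I = null_space (\<Phi> lam) I" for \<mu>
    using null_space_const[OF \<Phi> \<Phi> I(2,3)] by blast
  then have "rank (phi \<Psi> \<Phi> \<mu> I) = rank (phi \<Psi> \<Phi> lam I)" for \<mu>
    using *[of \<mu>] *[of lam] unfolding eq[of \<mu>] by linarith
  then have "rank_phi \<Psi> \<Phi> I = rank (phi \<Psi> \<Phi> lam I)"
    unfolding rank_phi_def by (intro the_equality) auto
  then show ?thesis
    using *[of lam] by simp
qed

section \<open>Maximal rank and the dimension count\<close>

lemma subspace_null_space: "vec.subspace (null_space F I)"
  by (simp add: vec.subspace_def null_space_def matrix_vector_right_distrib vector_scalar_commute)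

lemma null_space_UNIV:
  assumes \<Phi>: "\<And>\<mu>. fundamental_solution S \<Psi> k\<^sub>0 \<mu> (\<Phi> \<mu>)"
    and I: "finite I" "discrete_interval I" "k\<^sub>0 \<in> I"
    and maximal: "\<And>I'. finite I' \<Longrightarrow> discrete_interval I' \<Longrightarrow> I \<subseteq> I' \<Longrightarrow>
           rank_phi \<Psi> \<Phi> I' = rank_phi \<Psi> \<Phi> I"
  shows "null_space (\<Phi> lam) UNIV = null_space (\<Phi> lam) I"
proof
  show "null_space (\<Phi> lam) UNIV \<subseteq> null_space (\<Phi> lam) I"
    by (auto simp: null_space_def)
  show "null_space (\<Phi> lam) I \<subseteq> null_space (\<Phi> lam) UNIV"
  proof
    fix \<xi> assume \<xi>: "\<xi> \<in> null_space (\<Phi> lam) I"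
    have "\<Psi> k *v (\<Phi> lam k *v \<xi>) = 0" for k
    proof -
      \<comment> \<open>A finite discrete interval containing both \<open>I\<close> and
        \<open>k\<close>; maximality gives it the same nullity as \<open>I\<close>, and nested
        subspaces of equal dimension coincide.\<close>
      define I' where "I' = {0..max k (Max I)}"
      have I': "finite I'" "discrete_interval I'" "I \<subseteq> I'" "k \<in> I'"
        using I(1) by (auto simp: I'_def discrete_interval_atLeastAtMost le_max_iff_disj)
      have "vec.dim (null_space (\<Phi> lam) I) = vec.dim (null_space (\<Phi> lam) I')"
        using rank_phi_eq[OF \<Phi> I, of lam] rank_phi_eq[OF \<Phi> I'(1,2), of lam] maximal[OF I'(1-3)] I(3) I'(3)
        by auto
      moreover have "null_space (\<Phi> lam) I' \<subseteq> null_space (\<Phi> lam) I"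
        using I'(3) by (auto simp: null_space_def)
      ultimately have "null_space (\<Phi> lam) I' = null_space (\<Phi> lam) I"
        by (intro vec.subspace_dim_equal subspace_null_space) simp_all
      then have "\<xi> \<in> null_space (\<Phi> lam) I'"
        using \<xi> by simp
      then show ?thesis
        using I'(4) by (simp add: null_space_def)
    qed
    then show "\<xi> \<in> null_space (\<Phi> lam) UNIV"
      by (simp add: null_space_def)
  qed
qed

text \<open>Rank-nullity is applied twice on the space \<open>X\<close> of admissible initial
  vectors: to the injective map onto the solutions, and to its composition with the passage to
  classes.\<close>

lemma sol_dim_eq:
  assumes F: "fundamental_solution S \<Psi> k\<^sub>0 lam F"
  shows "sol_dim S \<Psi> lam = defect_dim S \<Psi> lam + vec.dim (null_space F UNIV)"
proof -
  define seq where "seq \<xi> = (\<lambda>k. F k *v \<xi>)" for \<xi>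
  define X where "X = {\<xi>. seq \<xi> \<in> l2_psi \<Psi>}"
  have seq: "seq 0 = (\<lambda>k. 0)" "seq (\<xi> + \<eta>) = (\<lambda>k. seq \<xi> k + seq \<eta> k)"
    "seq (c *s \<xi>) = (\<lambda>k. c *s seq \<xi> k)" for c \<xi> \<eta>
    by (simp_all add: seq_def matrix_vector_right_distrib vector_scalar_commute)
  have X: "vec.subspace X"
    by (simp add: vec.subspace_def X_def seq l2_psi_zero l2_psi_add l2_psi_scale)
  have init: "seq \<xi> k\<^sub>0 = \<xi>" for \<xi>
    by (simp add: seq_def fundamental_init[OF F])
  have img: "seq ` X = sol_space S \<Psi> lam"
  proof
    show "seq ` X \<subseteq> sol_space S \<Psi> lam"
      using solution_fundamental[OF F] by (auto simp: X_def sol_space_def seq_def solution_def)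
    show "sol_space S \<Psi> lam \<subseteq> seq ` X"
    proof
      fix z assume z: "z \<in> sol_space S \<Psi> lam"
      then have "z = seq (z k\<^sub>0)"
        using solution_fundamental[OF F, of "z k\<^sub>0"] init
        by (intro solution_unique[of lam _ _ k\<^sub>0]) (auto simp: sol_space_def solution_def seq_def)
      moreover have "z k\<^sub>0 \<in> X"
        using z calculation by (simp add: X_def sol_space_def)
      ultimately show "z \<in> seq ` X"
        by blast
    qed
  qed
  let ?W = "seq_space\<lparr>carrier := sol_space S \<Psi> lam\<rparr>"
  let ?Q = "(l2_quot \<Psi>)\<lparr>carrier := defect_space S \<Psi> lam\<rparr>"
  have sol: "sol_dim S \<Psi> lam + vec.dim {\<xi> \<in> X. seq \<xi> = \<zero>\<^bsub>?W\<^esub>} = vec.dim X"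
    unfolding sol_dim_def
    by (rule dim_linear_image[OF X]) (simp_all add: img seq seq_space_def)
  \<comment> \<open>Evaluation at \<open>k\<^sub>0\<close> recovers \<open>\<xi>\<close> from its
    sequence.\<close>
  have "{\<xi> \<in> X. seq \<xi> = \<zero>\<^bsub>?W\<^esub>} \<subseteq> {0}"
    using init by (auto simp: seq_space_def fun_eq_iff) metis
  then have inj: "vec.dim {\<xi> \<in> X. seq \<xi> = \<zero>\<^bsub>?W\<^esub>} = 0"
    by (simp add: vec.dim_eq_0)
  have defect: "defect_dim S \<Psi> lam + vec.dim {\<xi> \<in> X. psi_class \<Psi> (seq \<xi>) = \<zero>\<^bsub>?Q\<^esub>} = vec.dim X"
    unfolding defect_dim_def
  proof (rule dim_linear_image[OF X])
    show "(\<lambda>\<xi>. psi_class \<Psi> (seq \<xi>)) ` X = carrier ?Q"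
      by (simp add: defect_space_eq image_image flip: img)
    show "psi_class \<Psi> (seq 0) = \<zero>\<^bsub>?Q\<^esub>"
      by (simp add: seq l2_quot_def)
    show "psi_class \<Psi> (seq (\<xi> + \<eta>)) = psi_class \<Psi> (seq \<xi>) \<oplus>\<^bsub>?Q\<^esub> psi_class \<Psi> (seq \<eta>)"
      if "\<xi> \<in> X" "\<eta> \<in> X" for \<xi> \<eta>
      using l2_quot_add[of "seq \<xi>" "seq \<eta>"] that by (simp add: X_def seq)
    show "psi_class \<Psi> (seq (c *s \<xi>)) = c \<odot>\<^bsub>?Q\<^esub> psi_class \<Psi> (seq \<xi>)" if "\<xi> \<in> X" for c \<xi>
      using l2_quot_smult[of "seq \<xi>" c] that by (simp add: X_def seq)
  qed
  have ker: "{\<xi> \<in> X. psi_class \<Psi> (seq \<xi>) = \<zero>\<^bsub>?Q\<^esub>} = null_space F UNIV"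
  proof -
    have "\<zero>\<^bsub>?Q\<^esub> = psi_class \<Psi> (\<lambda>k. 0)"
      by (simp add: l2_quot_def)
    moreover have "psi_class \<Psi> (seq \<xi>) = psi_class \<Psi> (\<lambda>k. 0) \<longleftrightarrow> \<xi> \<in> null_space F UNIV" if "\<xi> \<in> X" for \<xi>
      using that psi_class_eq_iff[of "seq \<xi>" "\<lambda>k. 0"]
      by (simp add: X_def l2_psi_zero null_space_def seq_def)
    \<comment> \<open>The series defining square summability is identically zero here, so the whole
      null space lies in \<open>X\<close>.\<close>
    moreover have "\<xi> \<in> X" if "\<xi> \<in> null_space F UNIV" for \<xi>
    proof -
      have "quad k (seq \<xi> k) = 0" for k
        using that by (simp add: quad_eq_0 null_space_def seq_def)
      then show ?thesis
        by (simp add: X_def l2_psi_iff)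
    qed
    ultimately show ?thesis
      by auto
  qed
  show ?thesis
    using sol inj defect unfolding ker by linarith
qed

end

theorem theorem5p11:
  fixes S \<Psi> :: "nat \<Rightarrow> complex ^ ('n::finite + 'n) ^ ('n + 'n)"
    and \<Phi> :: "complex \<Rightarrow> nat \<Rightarrow> complex ^ ('n + 'n) ^ ('n + 'n)"
    and k\<^sub>0 :: nat and I :: "nat set" and lam :: complex
  assumes "\<And>k. ctransp (S k) ** symJ ** S k = symJ"
    and "\<And>k. pos_semidef (\<Psi> k)"
    and "\<And>k. \<Psi> k ** symJ ** \<Psi> k = 0"
    and "\<And>\<mu>. fundamental_solution S \<Psi> k\<^sub>0 \<mu> (\<Phi> \<mu>)"
    and "finite I" and "discrete_interval I" and "k\<^sub>0 \<in> I"
    and "\<And>I'. finite I' \<Longrightarrow> discrete_interval I' \<Longrightarrow> I \<subseteq> I' \<Longrightarrow>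
           rank_phi \<Psi> \<Phi> I' = rank_phi \<Psi> \<Phi> I"
  shows "int (sol_dim S \<Psi> lam) =
           int (defect_dim S \<Psi> lam) + 2 * int CARD('n) - int (rank_phi \<Psi> \<Phi> I)"
proof -
  interpret symplectic_system S \<Psi>
    using assms(1-3) by unfold_locales
  have "sol_dim S \<Psi> lam = defect_dim S \<Psi> lam + vec.dim (null_space (\<Phi> lam) UNIV)"
    using assms(4) by (rule sol_dim_eq)
  moreover have "null_space (\<Phi> lam) UNIV = null_space (\<Phi> lam) I"
    using assms(4-8) by (rule null_space_UNIV)
  moreover have "rank_phi \<Psi> \<Phi> I + vec.dim (null_space (\<Phi> lam) I) = 2 * CARD('n)"
    using assms(4-7) by (rule rank_phi_eq)
  ultimately show ?thesis
    by simp
qed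

end
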